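(* Let $k$ be a field and let $A$ and $B$ be connected graded $k$-algebras that are finitely generated in degree $1$. If $A\cong B$ as ungraded $k$-algebras, then $A\cong B$ as graded $k$-algebras.
   Context: All algebras are associative unital $k$-algebras. A graded algebra $A=\bigoplus_{i\ge 0}A_i$ is connected graded if $A_0=k$; it is finitely generated in degree $1$ if $\dim_k A_1<\infty$ and $A$ is generated as an algebra by $A_1$. *)

theory Defs
  imports Complex_Main
begin

definition k_algebra :: "('k::field \<Rightarrow> 'a::ring_1 \<Rightarrow> 'a) \<Rightarrow> bool" where
  "k_algebra s \<longleftrightarrow> Vector_Spaces.vector_space s \<and>
     (\<forall>c x y. s c (x * y) = s c x * y \<and> s c (x * y) = x * s c y)"

definition subalgebra :: "('k::field \<Rightarrow> 'a::ring_1 \<Rightarrow> 'a) \<Rightarrow> 'a set \<Rightarrow> bool" where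
  "subalgebra s S \<longleftrightarrow> module.subspace s S \<and> 1 \<in> S \<and> (\<forall>x\<in>S. \<forall>y\<in>S. x * y \<in> S)"

definition gen_subalgebra :: "('k::field \<Rightarrow> 'a::ring_1 \<Rightarrow> 'a) \<Rightarrow> 'a set \<Rightarrow> 'a set" where
  "gen_subalgebra s X = \<Inter> {S. subalgebra s S \<and> X \<subseteq> S}"

definition graded_algebra :: "('k::field \<Rightarrow> 'a::ring_1 \<Rightarrow> 'a) \<Rightarrow> (nat \<Rightarrow> 'a set) \<Rightarrow> bool" where
  "graded_algebra s G \<longleftrightarrow> k_algebra s \<and>
     (\<forall>i. module.subspace s (G i)) \<and>
     (\<forall>x. \<exists>!c :: nat \<Rightarrow> 'a. (\<forall>i. c i \<in> G i) \<and> finite {i. c i \<noteq> 0} \<and>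
            x = (\<Sum>i\<in>{i. c i \<noteq> 0}. c i)) \<and>
     (\<forall>i j. \<forall>x\<in>G i. \<forall>y\<in>G j. x * y \<in> G (i + j))"

definition connected_graded_fg1 :: "('k::field \<Rightarrow> 'a::ring_1 \<Rightarrow> 'a) \<Rightarrow> (nat \<Rightarrow> 'a set) \<Rightarrow> bool" where
  "connected_graded_fg1 s G \<longleftrightarrow> graded_algebra s G \<and>
     G 0 = range (\<lambda>c. s c 1) \<and>
     (\<exists>S. finite S \<and> module.span s S = G 1) \<and>
     gen_subalgebra s (G 1) = UNIV"

definition alg_iso :: "('k::field \<Rightarrow> 'a::ring_1 \<Rightarrow> 'a) \<Rightarrow> ('k \<Rightarrow> 'b::ring_1 \<Rightarrow> 'b) \<Rightarrow> ('a \<Rightarrow> 'b) \<Rightarrow> bool" where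
  "alg_iso sA sB f \<longleftrightarrow> bij f \<and> Vector_Spaces.linear sA sB f \<and>
     (\<forall>x y. f (x * y) = f x * f y) \<and> f 1 = 1"

definition graded_alg_iso :: "('k::field \<Rightarrow> 'a::ring_1 \<Rightarrow> 'a) \<Rightarrow> (nat \<Rightarrow> 'a set) \<Rightarrow>
    ('k \<Rightarrow> 'b::ring_1 \<Rightarrow> 'b) \<Rightarrow> (nat \<Rightarrow> 'b set) \<Rightarrow> ('a \<Rightarrow> 'b) \<Rightarrow> bool" where
  "graded_alg_iso sA GA sB GB f \<longleftrightarrow> alg_iso sA sB f \<and> (\<forall>i. f ` GA i = GB i)"

end

theory Submission
  imports Defs
begin

text \<open>An isomorphism \<open>f : A \<rightarrow> B\<close> need not respect the augmentation ideals. However, since \<open>B\<close> and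
  \<open>A\<close> are generated in degree 1, every element of \<open>B\<close> is congruent modulo \<open>B\<^sub>\<ge>\<^sub>n\<close> to an element of
  \<open>f(A\<^sub><\<^sub>n)\<close>, that is, the truncation \<open>A\<^sub><\<^sub>n \<rightarrow> B\<^sub><\<^sub>n\<close> of \<open>f\<close> is surjective. The same holds for the inverse of
  \<open>f\<close>, so by finite dimensionality \<open>A\<^sub><\<^sub>n\<close> meets \<open>f\<^sup>-\<^sup>1(B\<^sub>\<ge>\<^sub>n)\<close> only in 0. Hence every \<open>a \<in> A\<^sub>i\<close> is the
  top component of a unique \<open>y \<in> A\<^sub>\<le>\<^sub>i\<close> with \<open>f(y) \<in> B\<^sub>\<ge>\<^sub>i\<close>, and sending \<open>a\<close> to the degree \<open>i\<close>
  component of \<open>f(y)\<close> is a graded isomorphism.\<close>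

section \<open>Linear algebra: surjectivity implies injectivity in finite dimension\<close>

text \<open>Dropping a redundant vector of \<open>T\<close> would leave fewer than
  \<open>card B\<close> vectors spanning the independent set \<open>B\<close>, against the exchange
  bound.\<close>

lemma (in vector_space) independent_if_card_le_span:
  assumes "finite T" "independent B" "B \<subseteq> span T" "card T \<le> card B"
  shows "independent T"
proof
  assume "dependent T"
  then obtain a where a: "a \<in> T" "a \<in> span (T - {a})"
    unfolding dependent_def by blast
  have "span T = span (T - {a})"
    using a by (metis insert_Diff span_redundant)
  then have "card B \<le> card (T - {a})"
    using independent_span_bound[of "T - {a}" B] assms by simp
  moreover have "card (T - {a}) < card T"
    using a assms(1) by (intro psubset_card_mono) auto
  ultimately show False using assms(4) by linarith
qed

text \<open>The image of a basis \<open>B\<close> of \<open>span S\<close> still spans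
  \<open>B\<close>, so by counting it has \<open>card B\<close> elements and is independent.\<close>

lemma (in vector_space) linear_surj_on_span_imp_inj_on:
  assumes lin: "Vector_Spaces.linear scale scale U"
    and fin: "finite S"
    and surj: "span S \<subseteq> U ` span S"
  shows "inj_on U (span S)"
proof -
  interpret U: Vector_Spaces.linear scale scale U by (rule lin)
  obtain B where B: "B \<subseteq> S" "independent B" "S \<subseteq> span B"
    using maximal_independent_subset[of S] by blast
  have sp: "span B = span S"
    using B by (metis span_eq span_superset subset_trans)
  have fB: "finite B" using B fin finite_subset by blast
  have BU: "B \<subseteq> span (U ` B)"
    using surj B(1) sp span_superset[of S] by (auto simp: U.span_image)
  have "card B \<le> card (U ` B)"
    using independent_span_bound[of "U ` B" B] fB B(2) BU by simp
  then have c: "card (U ` B) = card B"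
    using card_image_le[OF fB, of U] by simp
  have "independent (U ` B)"
    by (rule independent_if_card_le_span[of _ B]) (use fB B BU c in auto)
  moreover have "inj_on U B" using c fB by (simp add: eq_card_imp_inj_on)
  ultimately show ?thesis
    using U.inj_on_span_independent_image sp by metis
qed

section \<open>Homogeneous components in a connected graded algebra\<close>

locale fg1_graded = vector_space s
  for s :: "'k::field \<Rightarrow> 'a::ring_1 \<Rightarrow> 'a" +
  fixes G :: "nat \<Rightarrow> 'a set"
  assumes fg1: "connected_graded_fg1 s G"
begin

lemma graded: "graded_algebra s G"
  using fg1 by (simp add: connected_graded_fg1_def)

lemma scale_mult_left: "s c x * y = s c (x * y)"
  and scale_mult_right: "x * s c y = s c (x * y)"
proof -
  have "k_algebra s" using graded by (simp add: graded_algebra_def)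
  then show "s c x * y = s c (x * y)" "x * s c y = s c (x * y)"
    unfolding k_algebra_def by metis+
qed

lemma subspace_G: "subspace (G i)"
  using graded by (simp add: graded_algebra_def)

lemma G_mult: "x \<in> G i \<Longrightarrow> y \<in> G j \<Longrightarrow> x * y \<in> G (i + j)"
  using graded by (simp add: graded_algebra_def)

definition decomp :: "'a \<Rightarrow> (nat \<Rightarrow> 'a) \<Rightarrow> bool" where
  "decomp x c \<longleftrightarrow> (\<forall>i. c i \<in> G i) \<and> finite {i. c i \<noteq> 0} \<and> x = (\<Sum>i\<in>{i. c i \<noteq> 0}. c i)"

lemma ex1_decomp: "\<exists>!c. decomp x c"
  using graded unfolding graded_algebra_def decomp_def by blast

definition cmp :: "'a \<Rightarrow> nat \<Rightarrow> 'a" where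
  "cmp x = (THE c. decomp x c)"

lemma decomp_cmp: "decomp x (cmp x)"
  unfolding cmp_def by (rule theI'[OF ex1_decomp])

lemma cmp_eqI: "decomp x c \<Longrightarrow> cmp x = c"
  using ex1_decomp decomp_cmp by blast

lemma cmp_in: "cmp x i \<in> G i"
  using decomp_cmp unfolding decomp_def by blast

lemma finite_cmp: "finite {i. cmp x i \<noteq> 0}"
  using decomp_cmp unfolding decomp_def by blast

lemma sum_cmp: "finite I \<Longrightarrow> {i. cmp x i \<noteq> 0} \<subseteq> I \<Longrightarrow> (\<Sum>i\<in>I. cmp x i) = x"
  using decomp_cmp[of x] unfolding decomp_def
  by (metis (mono_tags, lifting) DiffD2 mem_Collect_eq sum.mono_neutral_left)

text \<open>Any finite superset \<open>I\<close> of the support will do, so exact supports of sums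
  and multiples need not be computed.\<close>

lemma decompI:
  assumes "\<And>i. c i \<in> G i" "finite I" "\<And>i. i \<notin> I \<Longrightarrow> c i = 0" "x = sum c I"
  shows "decomp x c"
proof -
  have sub: "{i. c i \<noteq> 0} \<subseteq> I" using assms(3) by blast
  have "sum c {i. c i \<noteq> 0} = sum c I"
    using assms sub by (intro sum.mono_neutral_left) auto
  then show ?thesis using assms sub finite_subset unfolding decomp_def by auto
qed

lemma cmp_add: "cmp (x + y) i = cmp x i + cmp y i"
proof -
  let ?I = "{i. cmp x i \<noteq> 0} \<union> {i. cmp y i \<noteq> 0}"
  have fin: "finite ?I" by (simp add: finite_cmp)
  have "decomp (x + y) (\<lambda>i. cmp x i + cmp y i)"
    by (rule decompI[OF _ fin])
       (auto simp: sum.distrib sum_cmp[OF fin] cmp_in subspace_G subspace_add)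
  then show ?thesis by (simp add: cmp_eqI)
qed

lemma cmp_scale: "cmp (s c x) i = s c (cmp x i)"
proof -
  have "decomp (s c x) (\<lambda>i. s c (cmp x i))"
    by (rule decompI[OF _ finite_cmp[of x]])
       (auto simp: scale_sum_right[symmetric] sum_cmp finite_cmp cmp_in subspace_G subspace_scale)
  then show ?thesis by (simp add: cmp_eqI)
qed

lemma cmp_zero [simp]: "cmp 0 i = 0"
  using cmp_add[of 0 0 i] by simp

lemma cmp_diff: "cmp (x - y) i = cmp x i - cmp y i"
  using cmp_add[of "x - y" y i] by simp

lemma cmp_sum: "cmp (sum h I) i = (\<Sum>j\<in>I. cmp (h j) i)"
  by (induction I rule: infinite_finite_induct) (auto simp: cmp_add)

lemma cmp_hom: "x \<in> G i \<Longrightarrow> cmp x j = (if j = i then x else 0)"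
proof -
  assume "x \<in> G i"
  then have "decomp x (\<lambda>j. if j = i then x else 0)"
    by (intro decompI[of _ "{i}"]) (auto simp: subspace_0 subspace_G)
  then show ?thesis by (simp add: cmp_eqI)
qed

lemma cmp_ext: "(\<And>i. cmp x i = cmp y i) \<Longrightarrow> x = y"
  by (metis finite_cmp order_refl sum_cmp ext)

lemma mem_G_iff: "x \<in> G i \<longleftrightarrow> (\<forall>j. j \<noteq> i \<longrightarrow> cmp x j = 0)"
proof
  assume *: "\<forall>j. j \<noteq> i \<longrightarrow> cmp x j = 0"
  have "(\<Sum>j\<in>{i}. cmp x j) = x" by (rule sum_cmp) (use * in auto)
  then show "x \<in> G i" using cmp_in[of x i] by simp
qed (simp add: cmp_hom)

lemma cmp_mult: "cmp (x * y) n = (\<Sum>i\<le>n. cmp x i * cmp y (n - i))"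
proof -
  \<comment> \<open>\<open>N\<close> also bounds \<open>n\<close>, so that the square of indices up
    to \<open>N\<close> contains every pair of degrees with sum \<open>n\<close>.\<close>
  obtain N where N: "{i. cmp x i \<noteq> 0} \<union> {i. cmp y i \<noteq> 0} \<union> {n} \<subseteq> {..N}"
    using finite_cmp[of x] finite_cmp[of y]
    by (metis finite.emptyI finite_Un finite_insert finite_nat_set_iff_bounded_le subsetI atMost_iff)
  have xy: "x * y = (\<Sum>i\<le>N. \<Sum>j\<le>N. cmp x i * cmp y j)"
    using N sum_cmp[of "{..N}" x] sum_cmp[of "{..N}" y]
    by (simp add: sum_product[symmetric])
  have "cmp (x * y) n = (\<Sum>i\<le>N. \<Sum>j\<le>N. cmp (cmp x i * cmp y j) n)"
    unfolding xy by (simp add: cmp_sum)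
  \<comment> \<open>The guard \<open>i \<le> n\<close> is essential: truncated subtraction would
    otherwise admit \<open>j = 0\<close> for every \<open>i > n\<close>.\<close>
  also have "\<dots> = (\<Sum>i\<le>N. \<Sum>j\<le>N. if j = n - i \<and> i \<le> n then cmp x i * cmp y j else 0)"
    by (intro sum.cong refl) (auto simp: cmp_hom[OF G_mult[OF cmp_in cmp_in]])
  also have "\<dots> = (\<Sum>i\<le>N. if i \<le> n then cmp x i * cmp y (n - i) else 0)"
    using N by (intro sum.cong refl) (auto simp: sum.delta)
  also have "\<dots> = (\<Sum>i\<le>n. cmp x i * cmp y (n - i))"
    using N by (intro sum.mono_neutral_cong_right) auto
  finally show ?thesis .
qed

lemma G0: "G 0 = range (\<lambda>c. s c 1)"
  using fg1 by (simp add: connected_graded_fg1_def)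

lemma one_in_G0: "1 \<in> G 0"
  unfolding G0 by (metis rangeI scale_one)

lemma cmp_one: "cmp 1 i = (if i = 0 then 1 else 0)"
  using cmp_hom[OF one_in_G0] .

section \<open>Generation in degree 1 and finite-dimensional components\<close>

lemma generation:
  assumes "subspace S" "1 \<in> S" "\<And>x y. x \<in> S \<Longrightarrow> y \<in> S \<Longrightarrow> x * y \<in> S" "G 1 \<subseteq> S"
  shows "x \<in> S"
proof -
  have "gen_subalgebra s (G 1) = UNIV" using fg1 by (simp add: connected_graded_fg1_def)
  moreover have "subalgebra s S" using assms by (simp add: subalgebra_def)
  ultimately show ?thesis using assms(4) unfolding gen_subalgebra_def by blast
qed

definition prods :: "'a set \<Rightarrow> 'a set \<Rightarrow> 'a set" where
  "prods X Y = (\<lambda>(x, y). x * y) ` (X \<times> Y)"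

lemma span_prods_mult:
  assumes "x \<in> span X" "y \<in> span Y"
  shows "x * y \<in> span (prods X Y)"
  using assms(1)
proof (induction rule: span_induct_alt)
  case (step c a z)
  have "a * y \<in> span (prods X Y)" using assms(2)
  proof (induction rule: span_induct_alt)
    case (step d b w)
    have "a * b \<in> span (prods X Y)"
      using \<open>a \<in> X\<close> \<open>b \<in> Y\<close> by (auto intro!: span_base simp: prods_def)
    then show ?case using step by (simp add: distrib_left scale_mult_right span_add span_scale)
  qed (simp add: span_zero)
  then show ?case using step by (simp add: distrib_right scale_mult_left span_add span_scale)
qed (simp add: span_zero)

text \<open>The elements whose positive-degree components all lie in these spans form a subalgebra
  containing \<open>G 1\<close>, hence everything.\<close>

lemma G_Suc_subset: "G (Suc n) \<subseteq> span (prods (G 1) (G n))"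
proof -
  let ?V = "\<lambda>n. span (prods (G 1) (G n))"
  let ?S = "{x. \<forall>n. cmp x (Suc n) \<in> ?V n}"
  \<comment> \<open>By associativity a right factor is absorbed into the second factor:
    \<open>(p * q) * b = p * (q * b)\<close>.\<close>
  have mul: "a * b \<in> ?V (n + j)" if "a \<in> ?V n" "b \<in> G j" for a b n j
    using that(1)
  proof (induction rule: span_induct_alt)
    case (step c a z)
    then obtain p q where "a = p * q" "p \<in> G 1" "q \<in> G n" by (auto simp: prods_def)
    then have "a * b \<in> ?V (n + j)"
      using G_mult[OF _ that(2)] by (auto intro!: span_base simp: prods_def mult.assoc)
    then show ?case using step by (simp add: distrib_right scale_mult_left span_add span_scale)
  qed (simp add: span_zero)
  have "x \<in> ?S" for x
  proof (rule generation)
    show "subspace ?S"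
      by (auto simp: subspace_def cmp_add cmp_scale span_add span_scale span_zero)
    show "1 \<in> ?S" by (simp add: cmp_one span_zero)
    show "G 1 \<subseteq> ?S"
    proof (intro subsetI CollectI allI)
      fix x n assume "x \<in> G 1"
      then show "cmp x (Suc n) \<in> ?V n"
        using one_in_G0 by (auto simp: cmp_hom span_zero prods_def intro!: span_base image_eqI[of x _ "(x, 1)"])
    qed
    show "x * y \<in> ?S" if "x \<in> ?S" "y \<in> ?S" for x y
    proof (intro CollectI allI)
      fix n
      \<comment> \<open>For \<open>i = 0\<close> the left factor is a scalar by connectedness, and
        the claim comes from \<open>y\<close>; otherwise it comes from \<open>x\<close> and
        \<open>mul\<close>.\<close>
      have "cmp x i * cmp y (Suc n - i) \<in> ?V n" if "i \<le> Suc n" for i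
      proof (cases i)
        case 0
        obtain c where "cmp x 0 = s c 1" using cmp_in[of x 0] by (auto simp: G0)
        then show ?thesis using 0 \<open>y \<in> ?S\<close> by (simp add: scale_mult_left span_scale)
      next
        case (Suc j)
        then show ?thesis using mul[of "cmp x i" j "cmp y (n - j)" "n - j"] \<open>x \<in> ?S\<close> that
          by (simp add: cmp_in)
      qed
      then show "cmp (x * y) (Suc n) \<in> ?V n"
        unfolding cmp_mult by (intro span_sum) auto
    qed
  qed
  then show ?thesis
    by (metis (mono_tags, lifting) cmp_hom mem_Collect_eq subsetI)
qed

text \<open>By \<open>G_Suc_subset\<close>, products of finite spanning sets in degrees 1 and
  \<open>n\<close> span degree \<open>n + 1\<close>.\<close>

lemma finite_span_G: "\<exists>S. finite S \<and> G n = span S"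
proof (induction n)
  case 0
  have "G 0 = span {1}" by (auto simp: G0 span_singleton)
  then show ?case by blast
next
  case (Suc n)
  then obtain T where T: "finite T" "G n = span T" by blast
  obtain S where S: "finite S" "span S = G 1"
    using fg1 by (auto simp: connected_graded_fg1_def)
  have "G (Suc n) \<subseteq> span (prods S T)"
    using G_Suc_subset
  proof (rule order_trans, intro span_minimal)
    show "prods (G 1) (G n) \<subseteq> span (prods S T)"
    proof
      fix x assume "x \<in> prods (G 1) (G n)"
      then obtain p q where "x = p * q" "p \<in> span S" "q \<in> span T"
        using S(2) T(2) by (auto simp: prods_def)
      then show "x \<in> span (prods S T)" by (simp add: span_prods_mult)
    qed
  qed simp
  moreover have "span (prods S T) \<subseteq> G (Suc n)"
  proof (intro span_minimal subspace_G)
    show "prods S T \<subseteq> G (Suc n)"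
      using S T G_mult[of _ 1 _ n] span_superset by (fastforce simp: prods_def)
  qed
  ultimately show ?case using S T by (metis antisym finite_SigmaI finite_imageI prods_def)
qed

section \<open>Filtrations by degree and truncation\<close>

definition lt :: "nat \<Rightarrow> 'a set" where
  "lt n = {x. \<forall>i\<ge>n. cmp x i = 0}"

definition ge :: "nat \<Rightarrow> 'a set" where
  "ge n = {x. \<forall>i<n. cmp x i = 0}"

text \<open>The projection onto \<open>lt n\<close> along \<open>ge n\<close>.\<close>

definition trunc :: "nat \<Rightarrow> 'a \<Rightarrow> 'a" where
  "trunc n x = (\<Sum>i<n. cmp x i)"

lemma cmp_trunc: "cmp (trunc n x) i = (if i < n then cmp x i else 0)"
  unfolding trunc_def by (auto simp: cmp_sum cmp_hom[OF cmp_in])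

lemma subspace_lt: "subspace (lt n)" and subspace_ge: "subspace (ge n)"
  by (auto simp: subspace_def lt_def ge_def cmp_add cmp_scale)

lemma finite_span_lt: "\<exists>S. finite S \<and> lt n = span S"
proof -
  obtain S where S: "\<And>i. finite (S i)" "\<And>i. G i = span (S i)"
    using finite_span_G by metis
  have "lt n = span (\<Union>i<n. S i)"
  proof (intro antisym subsetI)
    fix x assume "x \<in> lt n"
    then have "x = (\<Sum>i<n. cmp x i)"
      by (intro sum_cmp[symmetric]) (auto simp: lt_def not_le[symmetric])
    moreover have "cmp x i \<in> span (\<Union>i<n. S i)" if "i < n" for i
      using cmp_in[of x i] that span_mono[of "S i" "\<Union>i<n. S i"] S by auto
    ultimately show "x \<in> span (\<Union>i<n. S i)"
      by (metis (no_types, lifting) lessThan_iff span_sum)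
  next
    fix x assume x: "x \<in> span (\<Union>i<n. S i)"
    have "(\<Union>i<n. S i) \<subseteq> lt n"
      using S span_superset cmp_hom by (fastforce simp: lt_def)
    then show "x \<in> lt n" using span_minimal[OF _ subspace_lt] x by blast
  qed
  then show ?thesis using S by blast
qed

lemma ge_mult:
  assumes "x \<in> ge m" "y \<in> ge n"
  shows "x * y \<in> ge (m + n)"
proof -
  have "cmp x i * cmp y (k - i) = 0" if "k < m + n" "i \<le> k" for k i
    using assms that by (cases "i < m") (auto simp: ge_def)
  then show ?thesis by (simp add: ge_def cmp_mult)
qed

lemma lt_mult:
  assumes "x \<in> lt (Suc m)" "y \<in> lt (Suc n)"
  shows "x * y \<in> lt (Suc (m + n))"
proof -
  have "cmp x i * cmp y (k - i) = 0" if "Suc (m + n) \<le> k" "i \<le> k" for k i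
    using assms that by (cases "Suc m \<le> i") (auto simp: lt_def)
  then show ?thesis by (simp add: lt_def cmp_mult)
qed

text \<open>Every index other than \<open>m\<close> puts one factor above its degree bound, so only
  the top components contribute.\<close>

lemma cmp_mult_lt:
  assumes "x \<in> lt (Suc m)" "y \<in> lt (Suc n)"
  shows "cmp (x * y) (m + n) = cmp x m * cmp y n"
proof -
  have "(\<Sum>i\<le>m+n. cmp x i * cmp y (m + n - i)) = (\<Sum>i\<in>{m}. cmp x i * cmp y (m + n - i))"
  proof (intro sum.mono_neutral_right ballI)
    fix i assume "i \<in> {..m+n} - {m}"
    then show "cmp x i * cmp y (m + n - i) = 0"
      using assms by (cases "m < i") (auto simp: lt_def)
  qed auto
  then show ?thesis by (simp add: cmp_mult)
qed

text \<open>Dually, every index other than \<open>m\<close> puts one factor below its lowest degree.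
  Together with \<open>cmp_mult_lt\<close> this makes \<open>R\<close> multiplicative.\<close>

lemma cmp_mult_ge:
  assumes "x \<in> ge m" "y \<in> ge n"
  shows "cmp (x * y) (m + n) = cmp x m * cmp y n"
proof -
  have "(\<Sum>i\<le>m+n. cmp x i * cmp y (m + n - i)) = (\<Sum>i\<in>{m}. cmp x i * cmp y (m + n - i))"
  proof (intro sum.mono_neutral_right ballI)
    fix i assume "i \<in> {..m+n} - {m}"
    then show "cmp x i * cmp y (m + n - i) = 0"
      using assms by (cases "i < m") (auto simp: ge_def)
  qed auto
  then show ?thesis by (simp add: cmp_mult)
qed

lemma lt_mono: "m \<le> n \<Longrightarrow> lt m \<subseteq> lt n" and ge_mono: "m \<le> n \<Longrightarrow> ge n \<subseteq> ge m"
  by (auto simp: lt_def ge_def)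

lemma G_subset_ge: "G n \<subseteq> ge n" and G_subset_lt: "G n \<subseteq> lt (Suc n)"
  using cmp_hom by (auto simp: ge_def lt_def)

lemma ex_cmp:
  assumes "\<And>i. c i \<in> G i" "finite {i. c i \<noteq> 0}"
  shows "\<exists>x. \<forall>i. cmp x i = c i"
proof -
  have "decomp (\<Sum>i\<in>{i. c i \<noteq> 0}. c i) c" using assms by (simp add: decomp_def)
  then show ?thesis using cmp_eqI by metis
qed

end


section \<open>Surjectivity of the truncated isomorphism\<close>

locale graded_pair =
  A: fg1_graded sA GA + B: fg1_graded sB GB
  for sA :: "'k::field \<Rightarrow> 'a::ring_1 \<Rightarrow> 'a" and GA
    and sB :: "'k \<Rightarrow> 'b::ring_1 \<Rightarrow> 'b" and GB +
  fixes f :: "'a \<Rightarrow> 'b"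
  assumes iso: "alg_iso sA sB f"
begin

sublocale lin: Vector_Spaces.linear sA sB f
  using iso by (simp add: alg_iso_def)

lemma f_mult: "f (x * y) = f x * f y" and f_one: "f 1 = 1" and bij_f: "bij f"
  using iso by (simp_all add: alg_iso_def)

lemma f_inv: "f (inv f y) = y" and inv_f: "inv f (f x) = x"
  using bij_f by (simp_all add: bij_is_surj surj_f_inv_f bij_is_inj)

text \<open>\<open>hit n\<close> is all of \<open>B\<close> exactly when the truncation of
  \<open>f\<close> maps \<open>A.lt n\<close> onto \<open>B.lt n\<close>.\<close>

definition hit :: "nat \<Rightarrow> 'b set" where
  "hit n = {b. \<exists>u\<in>A.lt n. f u - b \<in> B.ge n}"

lemma subspace_hit: "B.subspace (hit n)"
  unfolding hit_def B.subspace_def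
proof (intro conjI ballI allI; (elim CollectE bexE)?; intro CollectI)
  show "\<exists>u\<in>A.lt n. f u - 0 \<in> B.ge n"
    using A.subspace_0[OF A.subspace_lt] B.subspace_0[OF B.subspace_ge] lin.zero by force
next
  fix b b' u u' assume *: "u \<in> A.lt n" "f u - b \<in> B.ge n" "u' \<in> A.lt n" "f u' - b' \<in> B.ge n"
  have "f (u + u') - (b + b') = (f u - b) + (f u' - b')" by (simp add: lin.add)
  then show "\<exists>u\<in>A.lt n. f u - (b + b') \<in> B.ge n"
    using * by (metis A.subspace_add A.subspace_lt B.subspace_add B.subspace_ge)
next
  fix c b u assume *: "u \<in> A.lt n" "f u - b \<in> B.ge n"
  have "f (sA c u) - sB c b = sB c (f u - b)" by (simp add: lin.scale B.scale_right_diff_distrib)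
  then show "\<exists>u\<in>A.lt n. f u - sB c b \<in> B.ge n"
    using * by (metis A.subspace_scale A.subspace_lt B.subspace_scale B.subspace_ge)
qed

lemma hit_add_ge: "b \<in> hit n \<Longrightarrow> c \<in> B.ge n \<Longrightarrow> b + c \<in> hit n"
  unfolding hit_def
proof (elim CollectE bexE, intro CollectI bexI)
  fix u assume "c \<in> B.ge n" "f u - b \<in> B.ge n"
  then show "f u - (b + c) \<in> B.ge n"
    using B.subspace_diff[OF B.subspace_ge, of "f u - b" n c] by (simp add: algebra_simps)
qed

lemma hit_0: "b \<in> hit 0"
  using A.subspace_0[OF A.subspace_lt] by (auto simp: hit_def B.ge_def)

lemma f_lt_in_hit: "u \<in> A.lt n \<Longrightarrow> f u \<in> hit n"
  using B.subspace_0[OF B.subspace_ge] by (auto simp: hit_def intro!: bexI[of _ u])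

lemma B_scalar_part:
  obtains c where "b - sB c 1 \<in> B.ge 1"
proof -
  obtain c where c: "B.cmp b 0 = sB c 1" using B.cmp_in[of b 0] by (auto simp: B.G0)
  have "b - sB c 1 \<in> B.ge 1" by (simp add: B.ge_def B.cmp_diff B.cmp_scale B.cmp_one c)
  then show ?thesis using that by blast
qed

lemma one_in_lt: "1 \<in> A.lt (Suc n)"
  by (simp add: A.lt_def A.cmp_one)

lemma hit_1: "b \<in> hit 1"
proof -
  obtain c where c: "b - sB c 1 \<in> B.ge 1" by (rule B_scalar_part)
  have "f 1 \<in> hit 1" using f_lt_in_hit one_in_lt[of 0] by simp
  then have "sB c 1 \<in> hit 1" using B.subspace_scale[OF subspace_hit] f_one by metis
  then show ?thesis using hit_add_ge c by fastforce
qed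

text \<open>Modulo \<open>B.ge 2\<close> a product \<open>(c + p) (d + q)\<close> with \<open>p\<close>, \<open>q\<close> of positive degree
  is the linear expression \<open>c (d + q) + d (c + p) - c d\<close>, so that no products are needed
  to reach \<open>B / B.ge 2\<close>.\<close>

lemma hit_2: "b \<in> hit 2"
proof -
  \<comment> \<open>The induction uses generators of \<open>A\<close> rather than of
    \<open>B\<close>, since \<open>f\<close> sends \<open>1\<close> and \<open>GA 1\<close> into
    \<open>hit 2\<close> at once.\<close>
  let ?S = "{a. f a \<in> hit 2}"
  have "a \<in> ?S" for a
  proof (rule A.generation)
    show "A.subspace ?S"
      using subspace_hit by (auto simp: A.subspace_def B.subspace_def lin.zero lin.add lin.scale)
    show "1 \<in> ?S" using f_lt_in_hit[of 1 2] one_in_lt[of 1] by (simp add: numeral_2_eq_2)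
    show "GA 1 \<subseteq> ?S" using f_lt_in_hit[of _ 2] A.G_subset_lt[of 1] by (auto simp: numeral_2_eq_2)
    show "x * y \<in> ?S" if xy: "x \<in> ?S" "y \<in> ?S" for x y
    proof -
      obtain c where c: "f x - sB c 1 \<in> B.ge 1" by (rule B_scalar_part)
      obtain d where d: "f y - sB d 1 \<in> B.ge 1" by (rule B_scalar_part)
      have "(f x - sB c 1) * (f y - sB d 1) \<in> B.ge 2"
        using B.ge_mult[OF c d] by (simp add: numeral_2_eq_2)
      moreover have "f 1 \<in> hit 2"
        using f_lt_in_hit[of 1 2] one_in_lt[of 1] by (simp add: numeral_2_eq_2)
      then have "sB c (f y) + sB d (f x) - sB c (sB d 1) \<in> hit 2"
        using xy by (intro B.subspace_diff B.subspace_add B.subspace_scale subspace_hit)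
          (auto simp: f_one)
      ultimately have "(sB c (f y) + sB d (f x) - sB c (sB d 1))
          + (f x - sB c 1) * (f y - sB d 1) \<in> hit 2"
        by (intro hit_add_ge)
      then show ?thesis
        by (simp add: algebra_simps B.scale_mult_left B.scale_mult_right f_mult)
    qed
  qed
  then show ?thesis by (metis f_inv mem_Collect_eq)
qed

text \<open>Degree \<open>n + 1\<close> is spanned by products \<open>p * q\<close> of degrees 1 and
  \<open>n\<close>. If \<open>f u\<close> approximates \<open>p\<close> modulo degree 2 and
  \<open>f v\<close> approximates \<open>q\<close> modulo degree \<open>n + 1\<close>, then
  \<open>f (u * v)\<close> approximates \<open>p * q\<close> modulo degree
  \<open>n + 2\<close>.\<close>

lemma G_hit_Suc:
  assumes IH: "\<And>b. b \<in> hit (Suc n)"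
  shows "GB (Suc n) \<subseteq> hit (Suc (Suc n))"
proof -
  have "B.prods (GB 1) (GB n) \<subseteq> hit (Suc (Suc n))"
  proof
    fix b assume "b \<in> B.prods (GB 1) (GB n)"
    then obtain p q where pq: "p \<in> GB 1" "q \<in> GB n" "b = p * q" by (auto simp: B.prods_def)
    obtain u where u: "u \<in> A.lt 2" "f u - p \<in> B.ge 2" using hit_2[of p] by (auto simp: hit_def)
    obtain v where v: "v \<in> A.lt (Suc n)" "f v - q \<in> B.ge (Suc n)"
      using IH[of q] by (auto simp: hit_def)
    have "u * v \<in> A.lt (Suc (Suc n))"
      using A.lt_mult[of u 1 v n] u v by (simp add: numeral_2_eq_2)
    moreover have "p * (f v - q) \<in> B.ge (Suc (Suc n))"
      using B.ge_mult[of p 1 "f v - q" "Suc n"] v pq B.G_subset_ge by auto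
    \<comment> \<open>\<open>f v\<close> inherits the lower bound \<open>n\<close> from
      \<open>q\<close>, which raises the error in \<open>p\<close> from degree 2 to degree
      \<open>n + 2\<close>.\<close>
    moreover have "f v \<in> B.ge n"
      using B.subspace_add[OF B.subspace_ge, of "f v - q" n q] v pq B.G_subset_ge B.ge_mono[of n "Suc n"]
      by auto
    then have "(f u - p) * f v \<in> B.ge (Suc (Suc n))"
      using B.ge_mult[of "f u - p" 2 "f v" n] u by simp
    moreover have "f (u * v) - b = (f u - p) * f v + p * (f v - q)"
      by (simp add: pq f_mult algebra_simps)
    ultimately show "b \<in> hit (Suc (Suc n))"
      unfolding hit_def using B.subspace_add[OF B.subspace_ge] by (metis (mono_tags) mem_Collect_eq)
  qed
  then show ?thesis using B.span_minimal[OF _ subspace_hit] B.G_Suc_subset by blast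
qed

text \<open>Successive approximation: the error \<open>r\<close> left modulo degree
  \<open>m + 1\<close> starts in degree \<open>m + 1\<close>, and \<open>G_hit_Suc\<close> reaches
  its lowest component.\<close>

lemma hit: "b \<in> hit n"
proof (induction n arbitrary: b rule: less_induct)
  case (less n)
  consider "n = 0" | "n = 1" | m where "n = Suc (Suc m)"
    by (metis One_nat_def not0_implies_Suc)
  then show ?case
  proof cases
    case 3
    have IH: "b \<in> hit (Suc m)" for b using less 3 by simp
    obtain u where u: "u \<in> A.lt (Suc m)" "f u - b \<in> B.ge (Suc m)"
      using IH[of b] by (auto simp: hit_def)
    define r where "r = b - f u"
    have r: "r \<in> B.ge (Suc m)"
      using B.subspace_neg[OF B.subspace_ge u(2)] by (simp add: r_def)
    have "r - B.cmp r (Suc m) \<in> B.ge n"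
      using r by (auto simp: 3 B.ge_def B.cmp_diff B.cmp_hom[OF B.cmp_in] less_Suc_eq)
    moreover have "B.cmp r (Suc m) \<in> hit n"
      using G_hit_Suc[OF IH] B.cmp_in 3 by blast
    ultimately have "r \<in> hit n" using hit_add_ge by fastforce
    moreover have "f u \<in> hit n" using u f_lt_in_hit A.lt_mono[of "Suc m" n] 3 by auto
    ultimately have "f u + r \<in> hit n" by (rule B.subspace_add[OF subspace_hit, rotated])
    then show ?thesis by (simp add: r_def)
  qed (use hit_0 hit_1 in auto)
qed

lemma trunc_f_surj: "B.lt n \<subseteq> (\<lambda>a. B.trunc n (f a)) ` A.lt n"
proof
  fix b assume b: "b \<in> B.lt n"
  obtain u where u: "u \<in> A.lt n" "f u - b \<in> B.ge n" using hit by (auto simp: hit_def)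
  have "b = B.trunc n (f u)"
    by (rule B.cmp_ext) (use b u in \<open>auto simp: B.cmp_trunc B.lt_def B.ge_def B.cmp_diff not_less\<close>)
  then show "b \<in> (\<lambda>a. B.trunc n (f a)) ` A.lt n" using u by blast
qed

section \<open>Injectivity of the truncation, by exchanging the two algebras\<close>

lemma alg_iso_inv: "alg_iso sB sA (inv f)"
proof -
  have "Vector_Spaces.linear sB sA (inv f)"
    by unfold_locales (metis f_inv inv_f lin.add lin.scale)+
  moreover have "inv f (x * y) = inv f x * inv f y" for x y by (metis f_inv inv_f f_mult)
  moreover have "inv f 1 = 1" by (metis inv_f f_one)
  ultimately show ?thesis using bij_f by (simp add: alg_iso_def bij_imp_bij_inv)
qed

end

lemma (in fg1_graded) linear_trunc: "Vector_Spaces.linear s s (trunc n)"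
  by unfold_locales (rule cmp_ext, simp add: cmp_trunc cmp_add cmp_scale)+

context graded_pair
begin

text \<open>The composite \<open>A.lt n \<rightarrow> B.lt n \<rightarrow> A.lt n\<close> of the two truncated isomorphisms is a surjective
  endomorphism of a finite-dimensional space.\<close>

lemma lt_ge_eq_0:
  assumes "a \<in> A.lt n" "f a \<in> B.ge n"
  shows "a = 0"
proof -
  \<comment> \<open>With the roles exchanged, \<open>trunc_f_surj\<close> also covers the truncated
    inverse.\<close>
  interpret inv: graded_pair sB GB sA GA "inv f"
    by unfold_locales (rule alg_iso_inv)
  define U where "U = A.trunc n \<circ> (inv f \<circ> (B.trunc n \<circ> f))"
  have lin: "Vector_Spaces.linear sA sA U"
    unfolding U_def
    by (intro Vector_Spaces.linear_compose[of _ sB] Vector_Spaces.linear_compose[of _ sA] lin.linear_axioms inv.lin.linear_axioms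
        A.linear_trunc B.linear_trunc)
  obtain S where S: "finite S" "A.lt n = A.span S" using A.finite_span_lt by blast
  have "U ` A.lt n = (\<lambda>b. A.trunc n (inv f b)) ` ((\<lambda>a. B.trunc n (f a)) ` A.lt n)"
    by (simp add: U_def image_comp comp_def)
  then have "A.lt n \<subseteq> U ` A.lt n"
    using inv.trunc_f_surj[of n] trunc_f_surj[of n] by (metis (no_types, lifting) image_mono subset_trans)
  then have inj: "inj_on U (A.lt n)"
    using A.linear_surj_on_span_imp_inj_on[OF lin S(1)] S(2) by simp
  have "B.trunc n (f a) = B.trunc n (f 0)"
    by (rule B.cmp_ext) (use assms(2) in \<open>auto simp: B.cmp_trunc B.ge_def lin.zero\<close>)
  then have "U a = U 0" by (simp add: U_def)
  then show ?thesis using inj assms(1) A.subspace_0[OF A.subspace_lt] by (auto dest: inj_onD)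
qed

section \<open>The isomorphism in each degree, as a relation\<close>

text \<open>The top component of \<open>y\<close> is matched with the lowest component of
  \<open>f y\<close>. As a relation it lets sums and products be checked on witnesses, before
  totality and uniqueness are known.\<close>

definition R :: "nat \<Rightarrow> 'a \<Rightarrow> 'b \<Rightarrow> bool" where
  "R i a b \<longleftrightarrow> (\<exists>y\<in>A.lt (Suc i). f y \<in> B.ge i \<and> A.cmp y i = a \<and> B.cmp (f y) i = b)"

lemma R_add: "R i a b \<Longrightarrow> R i a' b' \<Longrightarrow> R i (a + a') (b + b')"
  unfolding R_def
  by (metis A.cmp_add A.subspace_add A.subspace_lt B.cmp_add B.subspace_add B.subspace_ge lin.add)

lemma R_scale: "R i a b \<Longrightarrow> R i (sA c a) (sB c b)"
  unfolding R_def
  by (metis A.cmp_scale A.subspace_scale A.subspace_lt B.cmp_scale B.subspace_scale B.subspace_ge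
      lin.scale)

text \<open>The product of two witnesses is a witness: top components multiply in \<open>A\<close>,
  lowest components in \<open>B\<close>.\<close>

lemma R_mult: "R i a b \<Longrightarrow> R j a' b' \<Longrightarrow> R (i + j) (a * a') (b * b')"
  unfolding R_def
  by (metis A.cmp_mult_lt A.lt_mult B.cmp_mult_ge B.ge_mult f_mult)

lemma R_0_0: "R i 0 0"
  unfolding R_def
  by (rule bexI[of _ 0]) (auto simp: lin.zero A.subspace_0[OF A.subspace_lt] B.subspace_0[OF B.subspace_ge])

lemma R_sum: "(\<And>j. j \<in> J \<Longrightarrow> R i (a j) (b j)) \<Longrightarrow> R i (sum a J) (sum b J)"
  by (induction J rule: infinite_finite_induct) (auto simp: R_0_0 R_add)

lemma R_one: "R 0 1 1"
  unfolding R_def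
  by (rule bexI[of _ 1]) (auto simp: f_one A.cmp_one B.cmp_one B.ge_def one_in_lt)

lemma R_diff: "R i a b \<Longrightarrow> R i a' b' \<Longrightarrow> R i (a - a') (b - b')"
  using R_add[of i a b "- a'" "- b'"] R_scale[of i a' b' "- 1"] by simp

text \<open>Losing its top component puts the witness into \<open>A.lt i\<close>, where
  \<open>lt_ge_eq_0\<close> at level \<open>i\<close> kills it.\<close>

lemma R_0_left: "R i 0 b \<Longrightarrow> b = 0"
  unfolding R_def
proof (elim bexE conjE)
  fix y assume y: "y \<in> A.lt (Suc i)" "f y \<in> B.ge i" "A.cmp y i = 0" "B.cmp (f y) i = b"
  then have "y \<in> A.lt i" by (simp add: A.lt_def) (metis Suc_leI order_le_less)
  then have "y = 0" using lt_ge_eq_0 y(2) by blast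
  then show "b = 0" using y(4) lin.zero by simp
qed

text \<open>Here the image of the witness moves up to \<open>B.ge (Suc i)\<close>, and
  \<open>lt_ge_eq_0\<close> applies at level \<open>Suc i\<close>.\<close>

lemma R_0_right: "R i a 0 \<Longrightarrow> a = 0"
  unfolding R_def
proof (elim bexE conjE)
  fix y assume y: "y \<in> A.lt (Suc i)" "f y \<in> B.ge i" "A.cmp y i = a" "B.cmp (f y) i = 0"
  then have "f y \<in> B.ge (Suc i)" by (auto simp: B.ge_def less_Suc_eq)
  then have "y = 0" using lt_ge_eq_0 y(1) by blast
  then show "a = 0" using y(3) by simp
qed

lemma R_unique_right: "R i a b \<Longrightarrow> R i a b' \<Longrightarrow> b = b'"
  using R_diff[of i a b a b'] R_0_left by fastforce

lemma R_unique_left: "R i a b \<Longrightarrow> R i a' b \<Longrightarrow> a = a'"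
  using R_diff[of i a b a' b] R_0_right by fastforce

lemma R_total_left:
  assumes "a \<in> GA i"
  shows "\<exists>b\<in>GB i. R i a b"
proof -
  \<comment> \<open>The witness is \<open>a - u\<close>: subtracting \<open>u\<close> clears the
    part of \<open>f a\<close> below degree \<open>i\<close> without touching the top component
    \<open>a\<close>.\<close>
  obtain u where u: "u \<in> A.lt i" "f u - f a \<in> B.ge i" using hit by (auto simp: hit_def)
  have "f (a - u) \<in> B.ge i"
    using B.subspace_neg[OF B.subspace_ge u(2)] by (simp add: lin.diff)
  moreover have "a - u \<in> A.lt (Suc i)"
    using assms u A.G_subset_lt[of i] A.lt_mono[of i "Suc i"]
    by (intro A.subspace_diff[OF A.subspace_lt]) auto
  moreover have "A.cmp (a - u) i = a"
    using u assms by (simp add: A.cmp_diff A.cmp_hom A.lt_def)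
  ultimately show ?thesis unfolding R_def using B.cmp_in by blast
qed

lemma R_total_right:
  assumes "b \<in> GB i"
  shows "\<exists>a\<in>GA i. R i a b"
proof -
  \<comment> \<open>Level \<open>Suc i\<close> rather than \<open>i\<close> makes \<open>f u\<close>
    agree with \<open>b\<close> in degree \<open>i\<close> as well, so \<open>u\<close> itself is
    the witness.\<close>
  obtain u where u: "u \<in> A.lt (Suc i)" "f u - b \<in> B.ge (Suc i)" using hit by (auto simp: hit_def)
  have *: "B.cmp (f u) j = B.cmp b j" if "j \<le> i" for j
    using u(2) that by (simp add: B.ge_def B.cmp_diff)
  have "R i (A.cmp u i) b"
    unfolding R_def using * u(1) assms by (auto simp: B.ge_def B.cmp_hom intro!: bexI[of _ u])
  then show ?thesis using A.cmp_in by blast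
qed

section \<open>Assembling the degrees into a graded isomorphism\<close>

definition rel :: "'a \<Rightarrow> 'b \<Rightarrow> bool" where
  "rel x y \<longleftrightarrow> (\<forall>i. R i (A.cmp x i) (B.cmp y i))"

lemma rel_total_left: "\<exists>y. rel x y"
proof -
  obtain c where c: "\<And>i. c i \<in> GB i" "\<And>i. R i (A.cmp x i) (c i)"
    using R_total_left[OF A.cmp_in[of x]] by metis
  \<comment> \<open>Zero is related only to zero, so the chosen components inherit finite support
    from \<open>x\<close>.\<close>
  have "{i. c i \<noteq> 0} \<subseteq> {i. A.cmp x i \<noteq> 0}"
  proof (intro subsetI CollectI notI)
    fix i assume "i \<in> {i. c i \<noteq> 0}" "A.cmp x i = 0"
    then show False using c(2)[of i] R_0_left[of i "c i"] by simp
  qed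
  then have "finite {i. c i \<noteq> 0}" using A.finite_cmp finite_subset by blast
  then obtain y where "\<forall>i. B.cmp y i = c i" using B.ex_cmp[of c] c by blast
  then show ?thesis using c unfolding rel_def by metis
qed

lemma rel_total_right: "\<exists>x. rel x y"
proof -
  obtain c where c: "\<And>i. c i \<in> GA i" "\<And>i. R i (c i) (B.cmp y i)"
    using R_total_right[OF B.cmp_in[of y]] by metis
  have "{i. c i \<noteq> 0} \<subseteq> {i. B.cmp y i \<noteq> 0}"
  proof (intro subsetI CollectI notI)
    fix i assume "i \<in> {i. c i \<noteq> 0}" "B.cmp y i = 0"
    then show False using c(2)[of i] R_0_right[of i "c i"] by simp
  qed
  then have "finite {i. c i \<noteq> 0}" using B.finite_cmp finite_subset by blast
  then obtain x where "\<forall>i. A.cmp x i = c i" using A.ex_cmp[of c] c by blast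
  then show ?thesis using c unfolding rel_def by metis
qed

lemma rel_unique_right: "rel x y \<Longrightarrow> rel x y' \<Longrightarrow> y = y'"
  unfolding rel_def using R_unique_right B.cmp_ext by metis

lemma rel_unique_left: "rel x y \<Longrightarrow> rel x' y \<Longrightarrow> x = x'"
  unfolding rel_def using R_unique_left A.cmp_ext by metis

text \<open>The convolution formulas for both products have summands matched by
  \<open>R_mult\<close> in degrees \<open>i\<close> and \<open>n - i\<close>.\<close>

lemma rel_mult: "rel x y \<Longrightarrow> rel x' y' \<Longrightarrow> rel (x * x') (y * y')"
  unfolding rel_def A.cmp_mult B.cmp_mult
  by (intro allI R_sum) (metis R_mult atMost_iff le_add_diff_inverse)

text \<open>Homogeneity is the vanishing of the other components, and \<open>R\<close> matches zeros
  in both directions.\<close>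

lemma rel_mem_iff: "rel x y \<Longrightarrow> x \<in> GA i \<longleftrightarrow> y \<in> GB i"
  unfolding rel_def A.mem_G_iff B.mem_G_iff using R_0_left R_0_right by metis

lemma ex_graded_alg_iso: "\<exists>g. graded_alg_iso sA GA sB GB g"
proof -
  obtain g where g: "\<And>x. rel x (g x)" using rel_total_left by metis
  \<comment> \<open>Uniqueness reduces each equation for the chosen \<open>g\<close> to an instance
    of \<open>rel\<close>.\<close>
  have eq: "g x = y" if "rel x y" for x y using g rel_unique_right that by blast
  have "inj g" using g rel_unique_left by (metis injI)
  moreover have surj: "surj g" using eq rel_total_right by (metis surjI)
  moreover have "Vector_Spaces.linear sA sB g"
  proof unfold_locales
    show "g (x + y) = g x + g y" for x y
      using g by (intro eq) (simp add: rel_def A.cmp_add B.cmp_add R_add)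
    show "g (sA c x) = sB c (g x)" for c x
      using g by (intro eq) (simp add: rel_def A.cmp_scale B.cmp_scale R_scale)
  qed
  moreover have "g (x * y) = g x * g y" for x y using g by (intro eq rel_mult)
  moreover have "g 1 = 1" by (rule eq) (simp add: rel_def A.cmp_one B.cmp_one R_one R_0_0)
  moreover have "g ` GA i = GB i" for i
    using rel_mem_iff[OF g] surj by (auto simp: image_iff) (metis surjD)
  ultimately show ?thesis unfolding graded_alg_iso_def alg_iso_def bij_def by blast
qed

end

theorem theorem1:
  fixes sA :: "'k::field \<Rightarrow> 'a::ring_1 \<Rightarrow> 'a"
    and sB :: "'k \<Rightarrow> 'b::ring_1 \<Rightarrow> 'b"
    and GA :: "nat \<Rightarrow> 'a set" and GB :: "nat \<Rightarrow> 'b set"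
  assumes "connected_graded_fg1 sA GA"
    and "connected_graded_fg1 sB GB"
    and "\<exists>f. alg_iso sA sB f"
  shows "\<exists>g. graded_alg_iso sA GA sB GB g"
proof -
  obtain f where f: "alg_iso sA sB f" using assms(3) by blast
  have "Vector_Spaces.vector_space sA" "Vector_Spaces.vector_space sB"
    using assms(1,2) by (simp_all add: connected_graded_fg1_def graded_algebra_def k_algebra_def)
  then interpret graded_pair sA GA sB GB f
    using assms f by (intro graded_pair.intro fg1_graded.intro fg1_graded_axioms.intro
        graded_pair_axioms.intro)
  show ?thesis by (rule ex_graded_alg_iso)
qed

end
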